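(* Let $R$ be a ring and let $M$ be a critically compressible left $R$-module. Then $M$ is a CS module. Moreover, $M$ is continuous if and only if every nonzero partial monomorphism of $M$ (that is, every nonzero monomorphism $f:N\to M$ with $N$ a submodule of $M$) is an isomorphism onto $M$.
   Context: Rings are associative with identity $1\neq 0$; modules are unitary left modules. A nonzero module $M$ is compressible if for every nonzero submodule $N\le M$ there is a monomorphism $M\to N$. A module $M$ is critically compressible if it is compressible and, in addition, there is no monomorphism $M\to M/N$ for any nonzero submodule $N\le M$. Consider the conditions: $(C_1)$ every submodule of $M$ is essential in a direct summand of $M$; $(C_2)$ if a submodule of $M$ is isomorphic to a direct summand of $M$, then it is itself a direct summand of $M$. $M$ is a CS module (extending module) if it satisfies $(C_1)$, and continuous if it satisfies $(C_1)$ and $(C_2)$. *)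

theory Defs
  imports "HOL-Algebra.Module" "HOL-Algebra.AbelCoset"
begin

text \<open>The library locale \<^locale>\<open>module\<close> requires a commutative ring of scalars. The following locale
  repeats its axioms over an arbitrary ring.\<close>

locale left_module = R?: ring R + M?: abelian_group M for R (structure) and M (structure) +
  assumes smult_closed [simp, intro]:
      "\<lbrakk>a \<in> carrier R; x \<in> carrier M\<rbrakk> \<Longrightarrow> a \<odot>\<^bsub>M\<^esub> x \<in> carrier M"
    and smult_l_distr:
      "\<lbrakk>a \<in> carrier R; b \<in> carrier R; x \<in> carrier M\<rbrakk> \<Longrightarrow>
      (a \<oplus> b) \<odot>\<^bsub>M\<^esub> x = a \<odot>\<^bsub>M\<^esub> x \<oplus>\<^bsub>M\<^esub> b \<odot>\<^bsub>M\<^esub> x"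
    and smult_r_distr:
      "\<lbrakk>a \<in> carrier R; x \<in> carrier M; y \<in> carrier M\<rbrakk> \<Longrightarrow>
      a \<odot>\<^bsub>M\<^esub> (x \<oplus>\<^bsub>M\<^esub> y) = a \<odot>\<^bsub>M\<^esub> x \<oplus>\<^bsub>M\<^esub> a \<odot>\<^bsub>M\<^esub> y"
    and smult_assoc1:
      "\<lbrakk>a \<in> carrier R; b \<in> carrier R; x \<in> carrier M\<rbrakk> \<Longrightarrow>
      (a \<otimes> b) \<odot>\<^bsub>M\<^esub> x = a \<odot>\<^bsub>M\<^esub> (b \<odot>\<^bsub>M\<^esub> x)"
    and smult_one [simp]:
      "x \<in> carrier M \<Longrightarrow> \<one> \<odot>\<^bsub>M\<^esub> x = x"

text \<open>The library locale \<^locale>\<open>submodule\<close> does not refer to commutativity of the scalars and is used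
  as it is. A submodule \<open>N\<close> of \<open>M\<close>, regarded as a module, is \<open>M\<lparr>carrier := N\<rparr>\<close>.\<close>

definition lmod_hom ::
    "('r, 'x) ring_scheme \<Rightarrow> ('r, 'a, 'm) module_scheme \<Rightarrow> ('r, 'b, 'n) module_scheme \<Rightarrow> ('a \<Rightarrow> 'b) set"
  where "lmod_hom R M N = {h \<in> hom (add_monoid M) (add_monoid N).
    \<forall>a\<in>carrier R. \<forall>x\<in>carrier M. h (a \<odot>\<^bsub>M\<^esub> x) = a \<odot>\<^bsub>N\<^esub> h x}"

definition lmod_mon ::
    "('r, 'x) ring_scheme \<Rightarrow> ('r, 'a, 'm) module_scheme \<Rightarrow> ('r, 'b, 'n) module_scheme \<Rightarrow> ('a \<Rightarrow> 'b) set"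
  where "lmod_mon R M N = {h \<in> lmod_hom R M N. inj_on h (carrier M)}"

definition lmod_iso ::
    "('r, 'x) ring_scheme \<Rightarrow> ('r, 'a, 'm) module_scheme \<Rightarrow> ('r, 'b, 'n) module_scheme \<Rightarrow> ('a \<Rightarrow> 'b) set"
  where "lmod_iso R M N = {h \<in> lmod_hom R M N. bij_betw h (carrier M) (carrier N)}"

text \<open>The fields \<^const>\<open>mult\<close> and \<^const>\<open>one\<close> of a module record carry no meaning. For a coset
  \<open>C = N + x\<close>, all the cosets \<open>N + a y\<close> with \<open>y \<in> C\<close> coincide with \<open>N + a x\<close>, hence so does their union.\<close>

definition quotient_module ::
    "('r, 'a, 'm) module_scheme \<Rightarrow> 'a set \<Rightarrow> ('r, 'a set) module"
  where "quotient_module M N =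
    \<lparr>carrier = a_rcosets\<^bsub>M\<^esub> N, mult = undefined, one = undefined, zero = N, add = set_add M,
     smult = (\<lambda>a C. \<Union>x\<in>C. N +>\<^bsub>M\<^esub> (a \<odot>\<^bsub>M\<^esub> x))\<rparr>"

definition compressible :: "('r, 'x) ring_scheme \<Rightarrow> ('r, 'a, 'm) module_scheme \<Rightarrow> bool"
  where "compressible R M \<longleftrightarrow> carrier M \<noteq> {\<zero>\<^bsub>M\<^esub>} \<and>
    (\<forall>N. submodule N R M \<and> N \<noteq> {\<zero>\<^bsub>M\<^esub>} \<longrightarrow> lmod_mon R M (M\<lparr>carrier := N\<rparr>) \<noteq> {})"

definition critically_compressible :: "('r, 'x) ring_scheme \<Rightarrow> ('r, 'a, 'm) module_scheme \<Rightarrow> bool"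
  where "critically_compressible R M \<longleftrightarrow> compressible R M \<and>
    (\<forall>N. submodule N R M \<and> N \<noteq> {\<zero>\<^bsub>M\<^esub>} \<longrightarrow> lmod_mon R M (quotient_module M N) = {})"

definition essential_submodule ::
    "'a set \<Rightarrow> ('r, 'x) ring_scheme \<Rightarrow> ('r, 'a, 'm) module_scheme \<Rightarrow> bool"
  where "essential_submodule N R M \<longleftrightarrow> submodule N R M \<and>
    (\<forall>K. submodule K R M \<and> K \<noteq> {\<zero>\<^bsub>M\<^esub>} \<longrightarrow> N \<inter> K \<noteq> {\<zero>\<^bsub>M\<^esub>})"

definition direct_summand ::
    "'a set \<Rightarrow> ('r, 'x) ring_scheme \<Rightarrow> ('r, 'a, 'm) module_scheme \<Rightarrow> bool"
  where "direct_summand D R M \<longleftrightarrow> submodule D R M \<and>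
    (\<exists>D'. submodule D' R M \<and> D <+>\<^bsub>M\<^esub> D' = carrier M \<and> D \<inter> D' = {\<zero>\<^bsub>M\<^esub>})"

definition condition_C1 :: "('r, 'x) ring_scheme \<Rightarrow> ('r, 'a, 'm) module_scheme \<Rightarrow> bool"
  where "condition_C1 R M \<longleftrightarrow> (\<forall>N. submodule N R M \<longrightarrow>
    (\<exists>D. direct_summand D R M \<and> essential_submodule N R (M\<lparr>carrier := D\<rparr>)))"

definition condition_C2 :: "('r, 'x) ring_scheme \<Rightarrow> ('r, 'a, 'm) module_scheme \<Rightarrow> bool"
  where "condition_C2 R M \<longleftrightarrow> (\<forall>N D. submodule N R M \<and> direct_summand D R M \<and>
    lmod_iso R (M\<lparr>carrier := N\<rparr>) (M\<lparr>carrier := D\<rparr>) \<noteq> {} \<longrightarrow> direct_summand N R M)"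

definition CS_module :: "('r, 'x) ring_scheme \<Rightarrow> ('r, 'a, 'm) module_scheme \<Rightarrow> bool"
  where "CS_module R M \<longleftrightarrow> condition_C1 R M"

definition continuous_module :: "('r, 'x) ring_scheme \<Rightarrow> ('r, 'a, 'm) module_scheme \<Rightarrow> bool"
  where "continuous_module R M \<longleftrightarrow> condition_C1 R M \<and> condition_C2 R M"

end

theory Submission
  imports Defs
begin

text \<open>Compressibility followed by the projection shows that a critically compressible module is
  uniform: if \<open>N \<inter> K = 0\<close> with both nonzero, a monomorphism \<open>M \<rightarrow> K\<close> stays injective modulo \<open>N\<close>.
  Hence every nonzero submodule is essential in \<open>M\<close>, and the only direct summands are \<open>0\<close> and \<open>M\<close>.
  Under \<open>(C\<^sub>2)\<close> every submodule isomorphic to \<open>M\<close> is therefore \<open>M\<close>. A nonzero submodule \<open>N\<close> contains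
  such a copy of \<open>M\<close>, so \<open>N = M\<close>, and every injective endomorphism of \<open>M\<close> is onto. Conversely, if
  all nonzero partial monomorphisms are isomorphisms onto \<open>M\<close>, then so are the inclusions of the
  nonzero submodules, so \<open>M\<close> is simple.\<close>

section \<open>Homomorphisms between module records\<close>

lemma lmod_homI:
  assumes "\<And>x. x \<in> carrier M \<Longrightarrow> h x \<in> carrier N"
    and "\<And>x y. x \<in> carrier M \<Longrightarrow> y \<in> carrier M \<Longrightarrow> h (x \<oplus>\<^bsub>M\<^esub> y) = h x \<oplus>\<^bsub>N\<^esub> h y"
    and "\<And>a x. a \<in> carrier R \<Longrightarrow> x \<in> carrier M \<Longrightarrow> h (a \<odot>\<^bsub>M\<^esub> x) = a \<odot>\<^bsub>N\<^esub> h x"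
  shows "h \<in> lmod_hom R M N"
  using assms by (auto simp: lmod_hom_def hom_def)

lemma lmod_homD:
  assumes "h \<in> lmod_hom R M N"
  shows "x \<in> carrier M \<Longrightarrow> h x \<in> carrier N"
    and "x \<in> carrier M \<Longrightarrow> y \<in> carrier M \<Longrightarrow> h (x \<oplus>\<^bsub>M\<^esub> y) = h x \<oplus>\<^bsub>N\<^esub> h y"
    and "a \<in> carrier R \<Longrightarrow> x \<in> carrier M \<Longrightarrow> h (a \<odot>\<^bsub>M\<^esub> x) = a \<odot>\<^bsub>N\<^esub> h x"
  using assms by (auto simp: lmod_hom_def hom_def Pi_iff)

lemma lmod_hom_compose:
  assumes "f \<in> lmod_hom R M N" "g \<in> lmod_hom R N P"
  shows "g \<circ> f \<in> lmod_hom R M P"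
  by (rule lmod_homI) (simp_all add: lmod_homD[OF assms(1)] lmod_homD[OF assms(2)])

lemma lmod_mon_restrict_codomain:
  assumes "f \<in> lmod_mon R M (N\<lparr>carrier := K\<rparr>)" "K \<subseteq> carrier N"
  shows "f \<in> lmod_mon R M N"
  using assms by (auto simp: lmod_mon_def lmod_hom_def hom_def)

text \<open>Condition \<open>(C\<^sub>2)\<close> asks for an isomorphism from the submodule to the
  summand, so for an image \<open>f(M)\<close> it is the inverse of \<open>f\<close> that is needed.
  The records are arbitrary here; closure of \<open>carrier M\<close> under sums and scalars is what
  lets \<open>inv_into\<close> cancel \<open>f\<close> on \<open>f (u + v)\<close> and
  \<open>f (a u)\<close>.\<close>

lemma lmod_iso_inv_into:
  assumes "f \<in> lmod_mon R M N"
    and "\<And>x y. x \<in> carrier M \<Longrightarrow> y \<in> carrier M \<Longrightarrow> x \<oplus>\<^bsub>M\<^esub> y \<in> carrier M"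
    and "\<And>a x. a \<in> carrier R \<Longrightarrow> x \<in> carrier M \<Longrightarrow> a \<odot>\<^bsub>M\<^esub> x \<in> carrier M"
  shows "inv_into (carrier M) f \<in> lmod_iso R (N\<lparr>carrier := f ` carrier M\<rparr>) M"
proof -
  have inj: "inj_on f (carrier M)" and h: "f \<in> lmod_hom R M N"
    using assms(1) by (auto simp: lmod_mon_def)
  have "inv_into (carrier M) f \<in> lmod_hom R (N\<lparr>carrier := f ` carrier M\<rparr>) M"
  proof (rule lmod_homI)
    fix x assume "x \<in> carrier (N\<lparr>carrier := f ` carrier M\<rparr>)"
    then show "inv_into (carrier M) f x \<in> carrier M"
      by (simp add: inv_into_into)
  next
    fix x y
    assume "x \<in> carrier (N\<lparr>carrier := f ` carrier M\<rparr>)" "y \<in> carrier (N\<lparr>carrier := f ` carrier M\<rparr>)"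
    then obtain u v where "u \<in> carrier M" "v \<in> carrier M" "x = f u" "y = f v" by auto
    then show "inv_into (carrier M) f (x \<oplus>\<^bsub>N\<lparr>carrier := f ` carrier M\<rparr>\<^esub> y) =
        inv_into (carrier M) f x \<oplus>\<^bsub>M\<^esub> inv_into (carrier M) f y"
      using inv_into_f_f[OF inj] assms(2) by (simp flip: lmod_homD(2)[OF h])
  next
    fix a x
    assume "a \<in> carrier R" "x \<in> carrier (N\<lparr>carrier := f ` carrier M\<rparr>)"
    then obtain u where "a \<in> carrier R" "u \<in> carrier M" "x = f u" by auto
    then show "inv_into (carrier M) f (a \<odot>\<^bsub>N\<lparr>carrier := f ` carrier M\<rparr>\<^esub> x) =
        a \<odot>\<^bsub>M\<^esub> inv_into (carrier M) f x"
      using inv_into_f_f[OF inj] assms(3) by (simp flip: lmod_homD(3)[OF h])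
  qed
  then show ?thesis
    using bij_betw_inv_into[OF inj_on_imp_bij_betw[OF inj]] by (simp add: lmod_iso_def)
qed

section \<open>Submodules of a left module\<close>

context left_module
begin

text \<open>Closure under negation comes from the scalar action: \<open>-x = (-1) x\<close>, because
  \<open>(-1) x + x = 0 x = 0\<close>.\<close>

lemma submoduleI:
  assumes "H \<subseteq> carrier M" "\<zero>\<^bsub>M\<^esub> \<in> H"
    and "\<And>x y. x \<in> H \<Longrightarrow> y \<in> H \<Longrightarrow> x \<oplus>\<^bsub>M\<^esub> y \<in> H"
    and smult: "\<And>a x. a \<in> carrier R \<Longrightarrow> x \<in> H \<Longrightarrow> a \<odot>\<^bsub>M\<^esub> x \<in> H"
  shows "submodule H R M"
proof -
  have "\<ominus>\<^bsub>M\<^esub> x \<in> H" if "x \<in> H" for x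
  proof -
    have x: "x \<in> carrier M" using that assms(1) by blast
    \<comment> \<open>An element with \<open>z + z = z\<close> in a group is zero.\<close>
    have "\<zero> \<odot>\<^bsub>M\<^esub> x \<oplus>\<^bsub>M\<^esub> \<zero> \<odot>\<^bsub>M\<^esub> x = \<zero> \<odot>\<^bsub>M\<^esub> x"
      using smult_l_distr[of \<zero> \<zero> x] x by simp
    then have z: "\<zero> \<odot>\<^bsub>M\<^esub> x = \<zero>\<^bsub>M\<^esub>" using x M.add.l_cancel_one' M.add.l_cancel_one by auto
    have "(\<ominus> \<one>) \<odot>\<^bsub>M\<^esub> x \<oplus>\<^bsub>M\<^esub> x = \<zero>\<^bsub>M\<^esub>"
      using smult_l_distr[of "\<ominus> \<one>" \<one> x] x z by (simp add: R.l_neg)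
    then have "\<ominus>\<^bsub>M\<^esub> x = (\<ominus> \<one>) \<odot>\<^bsub>M\<^esub> x" using x by (simp add: M.minus_equality)
    then show ?thesis using smult that by simp
  qed
  then show ?thesis
    using assms by (auto intro!: submodule.intro subgroup.intro
        simp: submodule_axioms_def simp flip: a_inv_def)
qed

lemma submoduleD:
  assumes "submodule H R M"
  shows "H \<subseteq> carrier M" and "\<zero>\<^bsub>M\<^esub> \<in> H"
    and "x \<in> H \<Longrightarrow> y \<in> H \<Longrightarrow> x \<oplus>\<^bsub>M\<^esub> y \<in> H"
    and "a \<in> carrier R \<Longrightarrow> x \<in> H \<Longrightarrow> a \<odot>\<^bsub>M\<^esub> x \<in> H"
  using subgroup.subset[OF submodule.axioms(1)[OF assms]]
    subgroup.one_closed[OF submodule.axioms(1)[OF assms]]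
    subgroup.m_closed[OF submodule.axioms(1)[OF assms]]
    submodule.smult_closed[OF assms]
  by auto

lemma smult_r_null [simp]:
  assumes "a \<in> carrier R"
  shows "a \<odot>\<^bsub>M\<^esub> \<zero>\<^bsub>M\<^esub> = \<zero>\<^bsub>M\<^esub>"
  using smult_r_distr[of a "\<zero>\<^bsub>M\<^esub>" "\<zero>\<^bsub>M\<^esub>"] assms by (auto simp: M.add.l_cancel_one')

lemma submodule_carrier: "submodule (carrier M) R M"
  by (rule submoduleI) auto

lemma submodule_zero: "submodule {\<zero>\<^bsub>M\<^esub>} R M"
  by (rule submoduleI) auto

lemma lmod_hom_zero:
  assumes "submodule N R M" "f \<in> lmod_hom R (M\<lparr>carrier := N\<rparr>) M"
  shows "f \<zero>\<^bsub>M\<^esub> = \<zero>\<^bsub>M\<^esub>"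
proof -
  have "f \<zero>\<^bsub>M\<^esub> \<oplus>\<^bsub>M\<^esub> f \<zero>\<^bsub>M\<^esub> = f \<zero>\<^bsub>M\<^esub>"
    using lmod_homD(2)[OF assms(2), of "\<zero>\<^bsub>M\<^esub>" "\<zero>\<^bsub>M\<^esub>"] submoduleD(2)[OF assms(1)] by simp
  moreover have "f \<zero>\<^bsub>M\<^esub> \<in> carrier M"
    using lmod_homD(1)[OF assms(2), of "\<zero>\<^bsub>M\<^esub>"] submoduleD(2)[OF assms(1)] by simp
  ultimately show ?thesis by (simp add: M.add.l_cancel_one)
qed

lemma lmod_hom_image_submodule:
  assumes "f \<in> lmod_hom R M M"
  shows "submodule (f ` carrier M) R M"
proof (rule submoduleI)
  show "f ` carrier M \<subseteq> carrier M" using lmod_homD(1)[OF assms] by blast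
  have "f \<zero>\<^bsub>M\<^esub> = \<zero>\<^bsub>M\<^esub>"
    using lmod_hom_zero[OF submodule_carrier] assms by simp
  then show "\<zero>\<^bsub>M\<^esub> \<in> f ` carrier M" by (metis M.zero_closed image_eqI)
next
  fix x y assume "x \<in> f ` carrier M" "y \<in> f ` carrier M"
  then show "x \<oplus>\<^bsub>M\<^esub> y \<in> f ` carrier M" by (auto simp flip: lmod_homD(2)[OF assms])
next
  fix a x assume "a \<in> carrier R" "x \<in> f ` carrier M"
  then show "a \<odot>\<^bsub>M\<^esub> x \<in> f ` carrier M" by (auto simp flip: lmod_homD(3)[OF assms])
qed

section \<open>The projection onto a quotient\<close>

lemma submodule_abelian_subgroup:
  assumes "submodule N R M"
  shows "abelian_subgroup N M"
  using assms M.abelian_group_axioms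
  by (auto intro!: abelian_subgroupI3 additive_subgroup.intro dest: submodule.axioms(1))

lemma quotient_proj_hom:
  assumes N: "submodule N R M"
  shows "(\<lambda>x. N +>\<^bsub>M\<^esub> x) \<in> lmod_hom R M (quotient_module M N)"
proof -
  interpret N: abelian_subgroup N M using submodule_abelian_subgroup[OF N] .
  show ?thesis
  proof (rule lmod_homI)
    fix x assume "x \<in> carrier M"
    then show "N +>\<^bsub>M\<^esub> x \<in> carrier (quotient_module M N)"
      by (simp add: quotient_module_def M.a_rcosetsI N.a_subset)
  next
    fix x y assume "x \<in> carrier M" "y \<in> carrier M"
    then show "N +>\<^bsub>M\<^esub> (x \<oplus>\<^bsub>M\<^esub> y) = (N +>\<^bsub>M\<^esub> x) \<oplus>\<^bsub>quotient_module M N\<^esub> (N +>\<^bsub>M\<^esub> y)"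
      by (simp add: quotient_module_def N.a_rcos_sum)
  next
    fix a x assume a: "a \<in> carrier R" and x: "x \<in> carrier M"
    \<comment> \<open>Independence of the representative: \<open>a y\<close> and \<open>a x\<close>
      differ by \<open>a n\<close>, which lies in \<open>N\<close>. Thus all members of the union
      defining the scalar action agree.\<close>
    have "N +>\<^bsub>M\<^esub> (a \<odot>\<^bsub>M\<^esub> y) = N +>\<^bsub>M\<^esub> (a \<odot>\<^bsub>M\<^esub> x)" if y: "y \<in> N +>\<^bsub>M\<^esub> x" for y
    proof -
      obtain n where n: "n \<in> N" "y = n \<oplus>\<^bsub>M\<^esub> x" using y by (auto simp: a_r_coset_def')
      then have "a \<odot>\<^bsub>M\<^esub> y = a \<odot>\<^bsub>M\<^esub> n \<oplus>\<^bsub>M\<^esub> a \<odot>\<^bsub>M\<^esub> x"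
        using a x submoduleD(1)[OF N] by (auto simp: smult_r_distr)
      then have "a \<odot>\<^bsub>M\<^esub> y \<in> N +>\<^bsub>M\<^esub> (a \<odot>\<^bsub>M\<^esub> x)"
        using submoduleD(4)[OF N a n(1)] by (auto simp: a_r_coset_def')
      then show ?thesis
        using a x N.a_subgroup by (metis M.a_repr_independence smult_closed)
    qed
    \<comment> \<open>The index set is nonempty, so the union of equal cosets is that coset and not
      the empty set.\<close>
    moreover have "x \<in> N +>\<^bsub>M\<^esub> x" using x by (rule N.a_rcos_self)
    ultimately have "(\<Union>y\<in>N +>\<^bsub>M\<^esub> x. N +>\<^bsub>M\<^esub> (a \<odot>\<^bsub>M\<^esub> y)) = N +>\<^bsub>M\<^esub> (a \<odot>\<^bsub>M\<^esub> x)" by blast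
    then show "N +>\<^bsub>M\<^esub> (a \<odot>\<^bsub>M\<^esub> x) = a \<odot>\<^bsub>quotient_module M N\<^esub> (N +>\<^bsub>M\<^esub> x)"
      by (simp add: quotient_module_def)
  qed
qed

text \<open>The kernel of the projection is \<open>N\<close>, so on \<open>K\<close> it is
  \<open>N \<inter> K\<close>. Concretely, if \<open>x\<close> and \<open>y\<close> in
  \<open>K\<close> have the same coset, then \<open>x - y\<close> lies in both submodules.\<close>

lemma quotient_proj_inj_on:
  assumes N: "submodule N R M" and K: "submodule K R M" and int: "N \<inter> K = {\<zero>\<^bsub>M\<^esub>}"
  shows "inj_on (\<lambda>x. N +>\<^bsub>M\<^esub> x) K"
proof (rule inj_onI)
  interpret N: abelian_subgroup N M using submodule_abelian_subgroup[OF N] .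
  interpret K: abelian_subgroup K M using submodule_abelian_subgroup[OF K] .
  fix x y assume xy: "x \<in> K" "y \<in> K" and eq: "N +>\<^bsub>M\<^esub> x = N +>\<^bsub>M\<^esub> y"
  have c: "x \<in> carrier M" "y \<in> carrier M" using xy by (auto intro: K.a_Hcarr)
  have "x \<in> N +>\<^bsub>M\<^esub> y" using N.a_rcos_self c(1) eq by blast
  then obtain n where n: "n \<in> N" "x = n \<oplus>\<^bsub>M\<^esub> y" by (auto simp: a_r_coset_def')
  then have nc: "n \<in> carrier M" by (auto intro: N.a_Hcarr)
  have "n = x \<oplus>\<^bsub>M\<^esub> (\<ominus>\<^bsub>M\<^esub> y)" using n nc c by (simp add: M.a_assoc M.r_neg)
  then have "n \<in> K" using xy by simp
  then have "n = \<zero>\<^bsub>M\<^esub>" using n int by blast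
  then show "x = y" using n c by simp
qed

section \<open>Uniformity, direct summands and \<open>(C\<^sub>1)\<close>\<close>

lemma critically_compressible_uniform:
  assumes cc: "critically_compressible R M"
    and N: "submodule N R M" "N \<noteq> {\<zero>\<^bsub>M\<^esub>}"
    and K: "submodule K R M" "K \<noteq> {\<zero>\<^bsub>M\<^esub>}"
  shows "N \<inter> K \<noteq> {\<zero>\<^bsub>M\<^esub>}"
proof
  assume int: "N \<inter> K = {\<zero>\<^bsub>M\<^esub>}"
  obtain f where f: "f \<in> lmod_mon R M (M\<lparr>carrier := K\<rparr>)"
    using cc K unfolding critically_compressible_def compressible_def by blast
  \<comment> \<open>The codomain is enlarged from \<open>K\<close> to \<open>M\<close>, so that
    \<open>f\<close> can be composed with the projection, which is defined on
    \<open>M\<close>.\<close>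
  then have f': "f \<in> lmod_hom R M M"
    using lmod_mon_restrict_codomain submoduleD(1)[OF K(1)] unfolding lmod_mon_def by blast
  have "f ` carrier M \<subseteq> K" "inj_on f (carrier M)"
    using f by (auto simp: lmod_mon_def dest: lmod_homD(1))
  then have "inj_on ((\<lambda>x. N +>\<^bsub>M\<^esub> x) \<circ> f) (carrier M)"
    using quotient_proj_inj_on[OF N(1) K(1) int] by (blast intro: comp_inj_on inj_on_subset)
  then have "(\<lambda>x. N +>\<^bsub>M\<^esub> x) \<circ> f \<in> lmod_mon R M (quotient_module M N)"
    using lmod_hom_compose[OF f' quotient_proj_hom[OF N(1)]] by (simp add: lmod_mon_def)
  then show False using cc N unfolding critically_compressible_def by blast
qed

lemma direct_summand_zero: "direct_summand {\<zero>\<^bsub>M\<^esub>} R M"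
  unfolding direct_summand_def
  by (intro conjI submodule_zero exI[of _ "carrier M"] submodule_carrier) (auto simp: set_add_def')

lemma direct_summand_carrier: "direct_summand (carrier M) R M"
  unfolding direct_summand_def
  by (intro conjI submodule_carrier exI[of _ "{\<zero>\<^bsub>M\<^esub>}"] submodule_zero) (auto simp: set_add_def')

text \<open>A complement meets \<open>D\<close> only in zero, so uniformity forces the complement of
  a nonzero \<open>D\<close> to vanish.\<close>

lemma critically_compressible_direct_summand:
  assumes cc: "critically_compressible R M" and D: "direct_summand D R M" "D \<noteq> {\<zero>\<^bsub>M\<^esub>}"
  shows "D = carrier M"
proof -
  obtain D' where D': "submodule D' R M" "D <+>\<^bsub>M\<^esub> D' = carrier M" "D \<inter> D' = {\<zero>\<^bsub>M\<^esub>}"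
    and sub: "submodule D R M"
    using D unfolding direct_summand_def by blast
  then have "D' = {\<zero>\<^bsub>M\<^esub>}" using critically_compressible_uniform[OF cc] D(2) by blast
  then show ?thesis using D'(2) submoduleD(1)[OF sub] by (force simp: set_add_def')
qed

lemma critically_compressible_C1:
  assumes cc: "critically_compressible R M"
  shows "condition_C1 R M"
  unfolding condition_C1_def
proof (intro allI impI)
  fix N assume N: "submodule N R M"
  show "\<exists>D. direct_summand D R M \<and> essential_submodule N R (M\<lparr>carrier := D\<rparr>)"
  proof (cases "N = {\<zero>\<^bsub>M\<^esub>}")
    case True
    \<comment> \<open>The zero submodule is not essential in the nonzero \<open>M\<close>; the
      summand chosen for it is itself. Essentiality in \<open>?Z\<close> is vacuous, since
      \<open>?Z\<close> has no nonzero submodule.\<close>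
    let ?Z = "M\<lparr>carrier := {\<zero>\<^bsub>M\<^esub>}\<rparr>"
    have triv: "K = {\<zero>\<^bsub>M\<^esub>}" if "submodule K R ?Z" for K
      using subgroup.subset[OF submodule.axioms(1)[OF that]]
        subgroup.one_closed[OF submodule.axioms(1)[OF that]] by auto
    have "group (add_monoid M)" by (rule M.a_group)
    then have "subgroup {\<zero>\<^bsub>M\<^esub>} (add_monoid M\<lparr>carrier := {\<zero>\<^bsub>M\<^esub>}\<rparr>)"
      by (metis group.subgroup_incl submodule_zero submodule.axioms(1) subset_refl)
    then have "submodule {\<zero>\<^bsub>M\<^esub>} R ?Z"
      by (auto intro!: submodule.intro simp: submodule_axioms_def)
    then have "essential_submodule N R ?Z"
      using True triv by (auto simp: essential_submodule_def)
    then show ?thesis using direct_summand_zero by blast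
  next
    case False
    then have "essential_submodule N R M"
      using N critically_compressible_uniform[OF cc] unfolding essential_submodule_def by blast
    then show ?thesis using direct_summand_carrier by (intro exI[of _ "carrier M"]) simp
  qed
qed

section \<open>Consequences of \<open>(C\<^sub>2)\<close> and the equivalence\<close>

lemma continuous_image_eq_carrier:
  assumes cc: "critically_compressible R M" and C2: "condition_C2 R M" and f: "f \<in> lmod_mon R M M"
  shows "f ` carrier M = carrier M"
proof (rule critically_compressible_direct_summand[OF cc])
  have f': "f \<in> lmod_hom R M M" "inj_on f (carrier M)" using f by (auto simp: lmod_mon_def)
  \<comment> \<open>The summand fed to \<open>(C\<^sub>2)\<close> is \<open>M\<close> itself,
    written as a record update to match the form of the condition.\<close>
  have "inv_into (carrier M) f \<in> lmod_iso R (M\<lparr>carrier := f ` carrier M\<rparr>) (M\<lparr>carrier := carrier M\<rparr>)"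
    using lmod_iso_inv_into[OF f] by simp
  then show "direct_summand (f ` carrier M) R M"
    using C2 lmod_hom_image_submodule[OF f'(1)] direct_summand_carrier
    unfolding condition_C2_def by blast
  show "f ` carrier M \<noteq> {\<zero>\<^bsub>M\<^esub>}"
  proof
    assume *: "f ` carrier M = {\<zero>\<^bsub>M\<^esub>}"
    \<comment> \<open>If the image is zero, \<open>x\<close> and zero have the same value under the
      injective \<open>f\<close>.\<close>
    have "x = \<zero>\<^bsub>M\<^esub>" if "x \<in> carrier M" for x
      using * that inj_onD[OF f'(2), of x "\<zero>\<^bsub>M\<^esub>"] by (metis M.zero_closed imageI singletonD)
    then have "carrier M = {\<zero>\<^bsub>M\<^esub>}" by auto
    then show False using cc by (auto simp: critically_compressible_def compressible_def)
  qed
qed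

text \<open>The compression of \<open>M\<close> into \<open>N\<close>, read as an injective
  endomorphism of \<open>M\<close>, is onto by \<open>(C\<^sub>2)\<close>, yet its image stays
  inside \<open>N\<close>.\<close>

lemma continuous_submodule_eq_carrier:
  assumes cc: "critically_compressible R M" and C2: "condition_C2 R M"
    and N: "submodule N R M" "N \<noteq> {\<zero>\<^bsub>M\<^esub>}"
  shows "N = carrier M"
proof -
  obtain g where g: "g \<in> lmod_mon R M (M\<lparr>carrier := N\<rparr>)"
    using cc N unfolding critically_compressible_def compressible_def by blast
  have "g ` carrier M = carrier M"
    using continuous_image_eq_carrier[OF cc C2]
      lmod_mon_restrict_codomain[OF g submoduleD(1)[OF N(1)]] by blast
  moreover have "g ` carrier M \<subseteq> N" using g by (auto simp: lmod_mon_def dest: lmod_homD(1))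
  ultimately show ?thesis using submoduleD(1)[OF N(1)] by blast
qed

lemma inclusion_lmod_mon: "submodule N R M \<Longrightarrow> id \<in> lmod_mon R (M\<lparr>carrier := N\<rparr>) M"
  using submoduleD(1)[of N] by (auto simp: lmod_mon_def intro!: lmod_homI)

end

theorem proposition2p6:
  fixes R :: "('r, 'x) ring_scheme" and M :: "('r, 'a, 'm) module_scheme"
  assumes "ring R" and "\<one>\<^bsub>R\<^esub> \<noteq> \<zero>\<^bsub>R\<^esub>"
    and "left_module R M"
    and "critically_compressible R M"
  shows "CS_module R M \<and>
    (continuous_module R M \<longleftrightarrow>
      (\<forall>N f. submodule N R M \<and> f \<in> lmod_mon R (M\<lparr>carrier := N\<rparr>) M \<and> (\<exists>x\<in>N. f x \<noteq> \<zero>\<^bsub>M\<^esub>)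
        \<longrightarrow> f \<in> lmod_iso R (M\<lparr>carrier := N\<rparr>) M))"
proof -
  interpret left_module R M by (rule assms(3))
  note cc = assms(4)
  have C1: "condition_C1 R M" by (rule critically_compressible_C1[OF cc])
  have "f \<in> lmod_iso R (M\<lparr>carrier := N\<rparr>) M"
    if C2: "condition_C2 R M" and N: "submodule N R M"
      and f: "f \<in> lmod_mon R (M\<lparr>carrier := N\<rparr>) M" and nz: "\<exists>x\<in>N. f x \<noteq> \<zero>\<^bsub>M\<^esub>" for N f
  proof -
    \<comment> \<open>A nonzero value excludes a zero domain because \<open>f\<close> sends zero to
      zero. With \<open>N = M\<close>, the map \<open>f\<close> becomes an injective endomorphism
      and is therefore onto.\<close>
    have "N \<noteq> {\<zero>\<^bsub>M\<^esub>}" using nz f lmod_hom_zero[OF N] by (auto simp: lmod_mon_def)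
    then have "N = carrier M" by (rule continuous_submodule_eq_carrier[OF cc C2 N])
    then show ?thesis
      using f continuous_image_eq_carrier[OF cc C2, of f]
      by (auto simp: lmod_mon_def lmod_iso_def bij_betw_def)
  qed
  moreover have "condition_C2 R M"
    if iso: "\<And>N f. submodule N R M \<Longrightarrow> f \<in> lmod_mon R (M\<lparr>carrier := N\<rparr>) M \<Longrightarrow>
      \<exists>x\<in>N. f x \<noteq> \<zero>\<^bsub>M\<^esub> \<Longrightarrow> f \<in> lmod_iso R (M\<lparr>carrier := N\<rparr>) M"
    unfolding condition_C2_def
  proof (intro allI impI, elim conjE)
    fix N assume N: "submodule N R M"
    show "direct_summand N R M"
    proof (cases "N = {\<zero>\<^bsub>M\<^esub>}")
      case True
      then show ?thesis using direct_summand_zero by simp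
    next
      case False
      then have "\<exists>x\<in>N. id x \<noteq> \<zero>\<^bsub>M\<^esub>" using submoduleD(2)[OF N] by auto
      \<comment> \<open>The inclusion of \<open>N\<close> is a nonzero partial monomorphism; being
        onto \<open>M\<close>, it gives \<open>N = M\<close>.\<close>
      then have "id \<in> lmod_iso R (M\<lparr>carrier := N\<rparr>) M" by (rule iso[OF N inclusion_lmod_mon[OF N]])
      then have "N = carrier M" by (auto simp: lmod_iso_def bij_betw_def)
      then show ?thesis using direct_summand_carrier by simp
    qed
  qed
  ultimately show ?thesis
    using C1 unfolding CS_module_def continuous_module_def by blast
qed

end
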